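(* Let $n\ge 2$. The $n$-dimensional Garrity–Schweiger algorithm $(\Delta,T)$ is algebraic self-dual, with intertwining map $\phi$ the fractional linear map associated with the $(n+1)\times(n+1)$ matrix $$A_\phi=\left(\begin{array}{cccc}1&\cdots&1&0\\ \vdots&\cdot^{\cdot^{\cdot}}&&\vdots\\ 1&&&0\\ 0&\cdots&0&1\end{array}\right),$$ i.e. (rows and columns indexed $0,\dots,n$) $(A_\phi)_{ij}=1$ if $0\le i,j\le n-1$ and $i+j\le n-1$, $(A_\phi)_{nn}=1$, and all other entries are $0$. That is, $\phi:\Delta^{\#}\to\Delta$ is a bijective, differentiable and measurable map, $\phi\circ T^{\#}=T\circ\phi$ on $\Delta^{\#}$, and $\phi(\mathring{\Delta^{\#}(k)})=\mathring{\Delta(k)}$ for all $k\in\mathbb{Z}_{\ge0}$.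
   Context: For an invertible matrix $A=(A_{ij})_{0\le i,j\le n}$ the associated fractional linear map is $x\mapsto y$ with $y_i=\dfrac{A_{i0}+\sum_{j=1}^nA_{ij}x_j}{A_{00}+\sum_{j=1}^nA_{0j}x_j}$, $1\le i\le n$. The symbol $\mathring{\ }$ denotes interior in $\mathbb{R}^n$. Garrity–Schweiger algorithm: $\Delta=\{x\in\mathbb{R}^n: 1\ge x_1\ge\cdots\ge x_n>0\}$ and $$T(x)=\left(\frac{x_2}{x_1},\dots,\frac{x_n}{x_1},\frac{1-x_1-kx_n}{x_1}\right),\qquad k=k(x)=\left\lfloor\frac{1-x_1}{x_n}\right\rfloor,$$ with partition $\Delta(k)=\{x\in\Delta:1-x_1-kx_n\ge0>1-x_1-(k+1)x_n\}$, $k\in\{0,1,2,\dots\}$. Its dual algorithm (given on each piece by the transposed matrices of $T$): $\Delta^{\#}=\{x\in\mathbb{R}^n:x_i\ge0\ (1\le i\le n-1),\ 0\le x_n<1\}$ and $$T^{\#}(x)=\left(\frac{1-x_n}{x_n},\frac{x_1}{x_n},\dots,\frac{x_{n-2}}{x_n},\frac{x_{n-1}-kx_n}{x_n}\right),\qquad k=\left\lfloor\frac{x_{n-1}}{x_n}\right\rfloor$$ (for $n=2$: $T^{\#}(x)=((1-x_2)/x_2,\ (x_1-kx_2)/x_2)$), with partition $\Delta^{\#}(k)=\{x\in\Delta^{\#}:x_{n-1}-kx_n\ge0>x_{n-1}-(k+1)x_n\}$. Algebraic self-dual (on the full digit set $\mathbb{Z}_{\ge0}$) means: there is a bijective, differentiable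 and measurable map $\phi:\Delta^{\#}\to\Delta$ with $\phi\circ T^{\#}=T\circ\phi$ and $\phi(\mathring{\Delta^{\#}(k)})=\mathring{\Delta(k)}$ for all digits $k$.
   Formalization: As printed φ is not a bijection Δ#→Δ (φ(0)=(1,…,1,0)∉Δ; points with y_n=y_{n-1} are missed) and T# is undefined at x_n=0; the claim is proved with {x_n=0} and {y_n=y_{n-1}} removed, and also from Δ# with face x_n=0 replaced by x_n=1 onto all of Δ. *)

theory Defs
  imports "HOL-Analysis.Analysis"
begin

text \<open>
  Points of n-dimensional space are vectors of type \<open>real ^ 'n\<close> with \<open>n = CARD('n)\<close>. The algorithms
  shift coordinates, so the index type has to be numbered: \<open>c\<close> is a bijection from
  \<open>{1..CARD('n)}\<close> onto \<open>'n\<close>, and the i-th coordinate of \<open>x\<close> is \<open>x $ c i\<close>.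
\<close>

definition numbering :: "(nat \<Rightarrow> 'n::finite) \<Rightarrow> bool" where
  "numbering c \<longleftrightarrow> bij_betw c {1..CARD('n)} UNIV"

definition position :: "(nat \<Rightarrow> 'n::finite) \<Rightarrow> 'n \<Rightarrow> nat" where
  "position c = inv_into {1..CARD('n)} c"

text \<open>
  Square matrices of size n+1 are indexed by \<open>'n option\<close>: \<open>None\<close> is the index 0 and
  \<open>Some (c i)\<close> is the index i.
\<close>

definition frac_lin :: "real ^ ('n option) ^ ('n option) \<Rightarrow> real ^ 'n \<Rightarrow> real ^ 'n::finite" where
  "frac_lin A x = (\<chi> l. (A $ Some l $ None + (\<Sum>m\<in>UNIV. A $ Some l $ Some m * x $ m)) /
                        (A $ None $ None + (\<Sum>m\<in>UNIV. A $ None $ Some m * x $ m)))"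

definition index0 :: "(nat \<Rightarrow> 'n::finite) \<Rightarrow> 'n option \<Rightarrow> nat" where
  "index0 c r = (case r of None \<Rightarrow> 0 | Some l \<Rightarrow> position c l)"

definition A_phi :: "(nat \<Rightarrow> 'n::finite) \<Rightarrow> real ^ ('n option) ^ ('n option)" where
  "A_phi c = (\<chi> r s. let n = CARD('n); i = index0 c r; j = index0 c s in
     if i \<le> n - 1 \<and> j \<le> n - 1 \<and> i + j \<le> n - 1 \<or> i = n \<and> j = n then 1 else 0)"

definition GS_domain :: "(nat \<Rightarrow> 'n::finite) \<Rightarrow> (real ^ 'n) set" where
  "GS_domain c = {x. x $ c 1 \<le> 1 \<and> (\<forall>i\<in>{1..<CARD('n)}. x $ c (i + 1) \<le> x $ c i) \<and>
                     0 < x $ c CARD('n)}"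

definition GS_map :: "(nat \<Rightarrow> 'n::finite) \<Rightarrow> real ^ 'n \<Rightarrow> real ^ 'n" where
  "GS_map c x = (\<chi> l. let n = CARD('n); i = position c l; k = \<lfloor>(1 - x $ c 1) / x $ c n\<rfloor> in
     if i < n then x $ c (i + 1) / x $ c 1
     else (1 - x $ c 1 - of_int k * x $ c n) / x $ c 1)"

definition GS_piece :: "(nat \<Rightarrow> 'n::finite) \<Rightarrow> nat \<Rightarrow> (real ^ 'n) set" where
  "GS_piece c k = {x \<in> GS_domain c. let n = CARD('n) in
     1 - x $ c 1 - real k * x $ c n \<ge> 0 \<and> 0 > 1 - x $ c 1 - (real k + 1) * x $ c n}"

definition GS_dual_domain :: "(nat \<Rightarrow> 'n::finite) \<Rightarrow> (real ^ 'n) set" where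
  "GS_dual_domain c = {x. (\<forall>i\<in>{1..CARD('n) - 1}. 0 \<le> x $ c i) \<and>
                          0 \<le> x $ c CARD('n) \<and> x $ c CARD('n) < 1}"

text \<open>The dual map is only meaningful where the last coordinate, by which it divides, is nonzero.\<close>

definition GS_dual_map :: "(nat \<Rightarrow> 'n::finite) \<Rightarrow> real ^ 'n \<Rightarrow> real ^ 'n" where
  "GS_dual_map c x = (\<chi> l. let n = CARD('n); i = position c l; k = \<lfloor>x $ c (n - 1) / x $ c n\<rfloor> in
     if i = 1 then (1 - x $ c n) / x $ c n
     else if i < n then x $ c (i - 1) / x $ c n
     else (x $ c (n - 1) - of_int k * x $ c n) / x $ c n)"

definition GS_dual_piece :: "(nat \<Rightarrow> 'n::finite) \<Rightarrow> nat \<Rightarrow> (real ^ 'n) set" where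
  "GS_dual_piece c k = {x \<in> GS_dual_domain c. let n = CARD('n) in
     x $ c (n - 1) - real k * x $ c n \<ge> 0 \<and> 0 > x $ c (n - 1) - (real k + 1) * x $ c n}"

text \<open>
  \<open>self_dual_via \<phi> X' T' P' X T P\<close>: the map \<open>\<phi>\<close> exhibits the algorithm \<open>(X, T)\<close> with pieces \<open>P k\<close> as
  algebraic self-dual, its dual being \<open>(X', T')\<close> with pieces \<open>P' k\<close>. The digit set is all of \<open>nat\<close>.
\<close>

definition self_dual_via ::
  "(real ^ 'n \<Rightarrow> real ^ 'n) \<Rightarrow>
   (real ^ 'n) set \<Rightarrow> (real ^ 'n \<Rightarrow> real ^ 'n) \<Rightarrow> (nat \<Rightarrow> (real ^ 'n) set) \<Rightarrow>
   (real ^ 'n) set \<Rightarrow> (real ^ 'n \<Rightarrow> real ^ 'n) \<Rightarrow> (nat \<Rightarrow> (real ^ 'n::finite) set) \<Rightarrow> bool" where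
  "self_dual_via \<phi> X' T' P' X T P \<longleftrightarrow>
     bij_betw \<phi> X' X \<and>
     \<phi> differentiable_on X' \<and>
     \<phi> \<in> restrict_space borel X' \<rightarrow>\<^sub>M restrict_space borel X \<and>
     (\<forall>x\<in>X'. \<phi> (T' x) = T (\<phi> x)) \<and>
     (\<forall>k. \<phi> ` interior (P' k) = interior (P k))"

text \<open>
  With the half-open domains exactly as above, the fractional linear map of \<open>A_phi\<close> sends the face
  \<open>x\<^sub>n = 0\<close> of the dual domain to \<open>y\<^sub>n = 0\<close>, outside \<open>GS_domain\<close>, and misses the face
  \<open>y\<^sub>n = y\<^sub>n\<^sub>-\<^sub>1\<close> of \<open>GS_domain\<close>, which corresponds to \<open>x\<^sub>n = 1\<close>. So it is a bijection between the two
  domains only after boundary faces have been adjusted. One way is to delete the two faces below;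
  the first of them is the set of points of the dual domain at which the dual map is undefined
  (they belong to no piece).
\<close>

definition GS_dual_null_face :: "(nat \<Rightarrow> 'n::finite) \<Rightarrow> (real ^ 'n) set" where
  "GS_dual_null_face c = {x \<in> GS_dual_domain c. x $ c CARD('n) = 0}"

definition GS_null_face :: "(nat \<Rightarrow> 'n::finite) \<Rightarrow> (real ^ 'n) set" where
  "GS_null_face c = {x \<in> GS_domain c. x $ c CARD('n) = x $ c (CARD('n) - 1)}"

text \<open>
  The other way is to keep \<open>GS_domain\<close> and to exchange the face \<open>x\<^sub>n = 0\<close> of the dual domain for
  the face \<open>x\<^sub>n = 1\<close>.
\<close>

definition GS_dual_domain_upper :: "(nat \<Rightarrow> 'n::finite) \<Rightarrow> (real ^ 'n) set" where
  "GS_dual_domain_upper c = {x. (\<forall>i\<in>{1..CARD('n) - 1}. 0 \<le> x $ c i) \<and>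
                                0 < x $ c CARD('n) \<and> x $ c CARD('n) \<le> 1}"

end

theory Submission
  imports Defs
begin

text \<open>
  Put \<open>S\<^sub>m(x) = 1 + x\<^sub>1 + \<dots> + x\<^sub>m\<close>. Then \<open>\<phi>(x)\<^sub>i = S\<^sub>n\<^sub>-\<^sub>1\<^sub>-\<^sub>i(x) / S\<^sub>n\<^sub>-\<^sub>1(x)\<close> for \<open>i < n\<close> and
  \<open>\<phi>(x)\<^sub>n = x\<^sub>n / S\<^sub>n\<^sub>-\<^sub>1(x)\<close>, so consecutive differences of the coordinates of \<open>\<phi>(x)\<close> recover those of
  \<open>x\<close>, and \<open>\<phi>\<close> is a bijection from the half-space \<open>S\<^sub>n\<^sub>-\<^sub>1 > 0\<close> onto \<open>y\<^sub>n\<^sub>-\<^sub>1 > 0\<close> under which the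
  inequalities that define the two domains and their pieces correspond. The dual map shifts the
  partial sums, \<open>S\<^sub>m(T\<^sup>#x) = S\<^sub>m\<^sub>-\<^sub>1(x) / x\<^sub>n\<close>, which gives the intertwining relation. The pieces
  match up to the face \<open>y\<^sub>n = y\<^sub>n\<^sub>-\<^sub>1\<close>, which lies on the boundary of a half-space containing
  the domain and hence is invisible to interiors; openness of \<open>\<phi>\<close> is invariance of domain.
\<close>

section \<open>Coordinates through the numbering\<close>

lemma numbering_inj:
  fixes c :: "nat \<Rightarrow> 'n::finite"
  assumes "numbering c" "i \<in> {1..CARD('n)}" "j \<in> {1..CARD('n)}"
  shows "c i = c j \<longleftrightarrow> i = j"
proof (rule inj_on_eq_iff)
  show "inj_on c {1..CARD('n)}"
    using assms(1) by (simp add: numbering_def bij_betw_def)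
qed (use assms in auto)

lemma position_numbering:
  fixes c :: "nat \<Rightarrow> 'n::finite"
  assumes "numbering c" "i \<in> {1..CARD('n)}"
  shows "position c (c i) = i"
  using assms unfolding numbering_def position_def
  by (intro inv_into_f_f) (auto simp: bij_betw_def)

lemma numbering_cases:
  fixes c :: "nat \<Rightarrow> 'n::finite"
  assumes "numbering c"
  obtains i where "i \<in> {1..CARD('n)}" "l = c i"
proof -
  have "l \<in> c ` {1..CARD('n)}"
    using assms by (simp add: numbering_def bij_betw_def)
  thus ?thesis using that by blast
qed

lemma sum_numbering:
  fixes c :: "nat \<Rightarrow> 'n::finite"
  assumes "numbering c"
  shows "(\<Sum>l\<in>UNIV. g l) = (\<Sum>j=1..CARD('n). g (c j))"
  using assms unfolding numbering_def by (rule sum.reindex_bij_betw[symmetric])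

lemma vec_eq_numbering:
  fixes c :: "nat \<Rightarrow> 'n::finite"
  assumes "numbering c" "\<And>i. 1 \<le> i \<Longrightarrow> i \<le> CARD('n) \<Longrightarrow> x $ c i = y $ c i"
  shows "x = y"
proof -
  have "x $ l = y $ l" for l
    by (rule numbering_cases[OF assms(1), of l]) (use assms(2) in auto)
  thus ?thesis by (simp add: vec_eq_iff)
qed

lemma index0_simps:
  fixes c :: "nat \<Rightarrow> 'n::finite"
  assumes "numbering c"
  shows "index0 c None = 0" "i \<in> {1..CARD('n)} \<Longrightarrow> index0 c (Some (c i)) = i"
  using position_numbering[OF assms] by (auto simp: index0_def)

section \<open>Partial sums and the two half-spaces\<close>

definition partial_sum :: "(nat \<Rightarrow> 'n::finite) \<Rightarrow> real ^ 'n \<Rightarrow> nat \<Rightarrow> real" where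
  "partial_sum c x m = 1 + (\<Sum>j=1..m. x $ c j)"

lemma partial_sum_0 [simp]: "partial_sum c x 0 = 1"
  by (simp add: partial_sum_def)

lemma partial_sum_Suc: "partial_sum c x (Suc m) = partial_sum c x m + x $ c (Suc m)"
  by (simp add: partial_sum_def)

lemma partial_sum_diff:
  assumes "m \<ge> 1"
  shows "partial_sum c x m - partial_sum c x (m - 1) = x $ c m"
  using assms partial_sum_Suc[of c x "m - 1"] by simp

lemma partial_sum_ge_1:
  assumes "\<And>j. j \<in> {1..m} \<Longrightarrow> 0 \<le> x $ c j"
  shows "partial_sum c x m \<ge> 1"
  using assms by (auto simp: partial_sum_def intro!: sum_nonneg)

text \<open>The partial sum here is the denominator of \<phi>. The set is open and contains both
  versions of the dual domain, so \<phi> can be inverted and differentiated on it without regard to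
  boundary faces.\<close>

definition dual_halfspace :: "(nat \<Rightarrow> 'n::finite) \<Rightarrow> (real ^ 'n) set" where
  "dual_halfspace c = {x. partial_sum c x (CARD('n) - 1) > 0}"

definition halfspace :: "(nat \<Rightarrow> 'n::finite) \<Rightarrow> (real ^ 'n) set" where
  "halfspace c = {y. y $ c (CARD('n) - 1) > 0}"

lemma open_dual_halfspace: "open (dual_halfspace c)"
  unfolding dual_halfspace_def partial_sum_def by (intro open_Collect_less continuous_intros)

section \<open>Coordinates of \<phi> and invertibility of its matrix\<close>

context
  fixes c :: "nat \<Rightarrow> 'n::finite" and n :: nat
  assumes num: "numbering c" and card2: "CARD('n) \<ge> 2"
  defines "n \<equiv> CARD('n)"
begin

lemma frac_lin_A_phi_denominator:
  "A_phi c $ None $ None + (\<Sum>m\<in>UNIV. A_phi c $ None $ Some m * x $ m) = partial_sum c x (n - 1)"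
proof -
  have "(\<Sum>m\<in>UNIV. A_phi c $ None $ Some m * x $ m) =
      (\<Sum>j=1..n. A_phi c $ None $ Some (c j) * x $ c j)"
    unfolding n_def by (rule sum_numbering[OF num])
  also have "\<dots> = (\<Sum>j=1..n-1. x $ c j)"
    using card2
    by (intro sum.mono_neutral_cong_right)
      (auto simp: A_phi_def Let_def index0_simps[OF num] n_def)
  finally show ?thesis
    using card2 by (simp add: partial_sum_def A_phi_def Let_def index0_simps[OF num])
qed

lemma frac_lin_A_phi_less:
  assumes "1 \<le> i" "i < n"
  shows "frac_lin (A_phi c) x $ c i = partial_sum c x (n - 1 - i) / partial_sum c x (n - 1)"
proof -
  have "(\<Sum>m\<in>UNIV. A_phi c $ Some (c i) $ Some m * x $ m) =
      (\<Sum>j=1..n. A_phi c $ Some (c i) $ Some (c j) * x $ c j)"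
    unfolding n_def by (rule sum_numbering[OF num])
  \<comment> \<open>Row \<open>i\<close> has its ones in the columns 0 to \<open>n - 1 - i\<close>;
    column 0 contributes the leading 1 of the partial sum.\<close>
  also have "\<dots> = (\<Sum>j=1..n-1-i. x $ c j)"
    using card2 assms
    by (intro sum.mono_neutral_cong_right)
      (auto simp: A_phi_def Let_def index0_simps[OF num] n_def)
  finally have "A_phi c $ Some (c i) $ None + (\<Sum>m\<in>UNIV. A_phi c $ Some (c i) $ Some m * x $ m) =
      partial_sum c x (n - 1 - i)"
    using card2 assms by (simp add: partial_sum_def A_phi_def Let_def index0_simps[OF num] n_def)
  thus ?thesis
    by (simp add: frac_lin_def frac_lin_A_phi_denominator)
qed

lemma frac_lin_A_phi_last:
  "frac_lin (A_phi c) x $ c n = x $ c n / partial_sum c x (n - 1)"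
proof -
  have "(\<Sum>m\<in>UNIV. A_phi c $ Some (c n) $ Some m * x $ m) =
      (\<Sum>j=1..n. A_phi c $ Some (c n) $ Some (c j) * x $ c j)"
    unfolding n_def by (rule sum_numbering[OF num])
  also have "\<dots> = (\<Sum>j\<in>{n}. x $ c j)"
    using card2
    by (intro sum.mono_neutral_cong_right)
      (auto simp: A_phi_def Let_def index0_simps[OF num] n_def)
  finally have "A_phi c $ Some (c n) $ None + (\<Sum>m\<in>UNIV. A_phi c $ Some (c n) $ Some m * x $ m) =
      x $ c n"
    using card2 by (simp add: A_phi_def Let_def index0_simps[OF num] n_def)
  thus ?thesis
    by (simp add: frac_lin_def frac_lin_A_phi_denominator)
qed

text \<open>The kernel is trivial: for a kernel vector \<open>v\<close>, the rows of index below
  \<open>n\<close> make all sums \<open>v\<^sub>0 + ... + v\<^sub>m\<close> with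
  \<open>m < n\<close> vanish, hence also their differences, and the last row isolates the remaining
  entry.\<close>

lemma invertible_A_phi: "invertible (A_phi c)"
proof -
  have "v = 0" if v: "A_phi c *v v = 0" for v
  proof -
    have row: "v $ None + (\<Sum>j=1..n. A_phi c $ r $ Some (c j) * v $ Some (c j)) = 0"
      if "index0 c r < n" for r
    proof -
      have "(A_phi c *v v) $ r = (\<Sum>s\<in>UNIV. A_phi c $ r $ s * v $ s)"
        by (simp add: matrix_vector_mult_def)
      also have "\<dots> = A_phi c $ r $ None * v $ None + (\<Sum>m\<in>UNIV. A_phi c $ r $ Some m * v $ Some m)"
        by (simp add: UNIV_option_conv sum.reindex)
      also have "(\<Sum>m\<in>UNIV. A_phi c $ r $ Some m * v $ Some m) =
          (\<Sum>j=1..n. A_phi c $ r $ Some (c j) * v $ Some (c j))"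
        unfolding n_def by (rule sum_numbering[OF num])
      also have "A_phi c $ r $ None = 1"
        using that card2 by (auto simp: A_phi_def Let_def index0_simps[OF num] n_def)
      finally show ?thesis
        using v by simp
    qed
    have psum: "v $ None + (\<Sum>j=1..m. v $ Some (c j)) = 0" if "m < n" for m
    proof -
      \<comment> \<open>The row of index \<open>n - 1 - m\<close> has ones exactly in the columns 0
        to \<open>m\<close>. For \<open>m = n - 1\<close> this is row 0, whose index is
        \<open>None\<close> and not a value of \<open>c\<close>.\<close>
      define r where "r = (if m = n - 1 then None else Some (c (n - 1 - m)))"
      have r: "index0 c r = n - 1 - m"
        using that by (auto simp: r_def index0_simps[OF num] n_def)
      have "(\<Sum>j=1..n. A_phi c $ r $ Some (c j) * v $ Some (c j)) = (\<Sum>j=1..m. v $ Some (c j))"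
        using that card2
        by (intro sum.mono_neutral_cong_right)
          (auto simp: A_phi_def Let_def r index0_simps[OF num] n_def)
      thus ?thesis
        using row[of r] r that by simp
    qed
    have v0: "v $ None = 0"
      using psum[of 0] card2 by (simp add: n_def)
    have vj: "v $ Some (c j) = 0" if "1 \<le> j" "j < n" for j
      using psum[of j] psum[of "j - 1"] that by (cases j) auto
    have vn: "v $ Some (c n) = 0"
    proof -
      have "(A_phi c *v v) $ Some (c n) = (\<Sum>s\<in>{Some (c n)}. v $ s)"
        unfolding matrix_vector_mult_def
      \<comment> \<open>Goal 3 says that the last row is zero off the diagonal, goal 4 uses that its
        diagonal entry is 1.\<close>
      proof (simp, subst sum.mono_neutral_right[of UNIV "{Some (c n)}"], goal_cases)
        case 3
        have "A_phi c $ Some (c n) $ s = 0" if "s \<noteq> Some (c n)" for s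
        proof (cases s)
          case None
          thus ?thesis using card2 by (simp add: A_phi_def Let_def index0_simps[OF num] n_def)
        next
          case (Some l)
          obtain i where i: "i \<in> {1..n}" "l = c i"
            using numbering_cases[OF num, of l] unfolding n_def by blast
          thus ?thesis using card2 that Some
            by (auto simp: A_phi_def Let_def index0_simps[OF num] n_def)
        qed
        thus ?case by simp
      next
        case 4
        show ?case using card2 by (simp add: A_phi_def Let_def index0_simps[OF num] n_def)
      qed auto
      thus ?thesis using v by simp
    qed
    have "v $ s = 0" for s
    proof (cases s)
      case (Some l)
      obtain i where "i \<in> {1..n}" "l = c i"
        using numbering_cases[OF num, of l] unfolding n_def by blast
      thus ?thesis using Some vj[of i] vn by (cases "i = n") auto
    qed (simp add: v0)
    thus ?thesis by (simp add: vec_eq_iff)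
  qed
  thus ?thesis
    by (simp add: invertible_left_inverse matrix_left_invertible_ker)
qed

section \<open>The bijection between the half-spaces\<close>

lemma frac_lin_A_phi_mem:
  assumes "x \<in> dual_halfspace c"
  shows "frac_lin (A_phi c) x \<in> halfspace c"
  using assms card2 frac_lin_A_phi_less[of "n - 1" x]
  by (auto simp: dual_halfspace_def halfspace_def n_def)

text \<open>Since \<open>S\<^sub>0 = 1\<close>, the coordinate
  \<open>y\<^sub>n\<^sub>-\<^sub>1\<close> is the reciprocal of the denominator, so
  \<open>S\<^sub>j\<close> is recovered as the quotient of the coordinate of index
  \<open>n - 1 - j\<close> by \<open>y\<^sub>n\<^sub>-\<^sub>1\<close>, and \<open>x\<^sub>j\<close>
  as \<open>S\<^sub>j - S\<^sub>j\<^sub>-\<^sub>1\<close>. The inner conditional supplies the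
  homogeneous coordinate \<open>y\<^sub>0 = 1\<close>, because \<open>c 0\<close> is not controlled
  by \<open>numbering\<close>.\<close>

definition phi_inv :: "real ^ 'n \<Rightarrow> real ^ 'n" where
  "phi_inv y = (\<chi> l. let j = position c l in
     if j < n then ((if j = n - 1 then 1 else y $ c (n - 1 - j)) - y $ c (n - j)) / y $ c (n - 1)
     else y $ c n / y $ c (n - 1))"

lemma phi_inv_less:
  assumes "1 \<le> j" "j < n"
  shows "phi_inv y $ c j =
    ((if j = n - 1 then 1 else y $ c (n - 1 - j)) - y $ c (n - j)) / y $ c (n - 1)"
  using assms position_numbering[OF num, of j] by (simp add: phi_inv_def n_def)

lemma phi_inv_last: "phi_inv y $ c n = y $ c n / y $ c (n - 1)"
proof -
  have "position c (c n) = n"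
    using position_numbering[OF num, of n] card2 by (simp add: n_def)
  thus ?thesis by (simp add: phi_inv_def)
qed

lemma phi_inv_frac_lin_A_phi:
  assumes "x \<in> dual_halfspace c"
  shows "phi_inv (frac_lin (A_phi c) x) = x"
proof (rule vec_eq_numbering[OF num])
  have pos: "partial_sum c x (n - 1) > 0"
    using assms by (simp add: dual_halfspace_def n_def)
  have last: "frac_lin (A_phi c) x $ c (n - 1) = 1 / partial_sum c x (n - 1)"
    using frac_lin_A_phi_less[of "n - 1" x] card2 by (simp add: n_def)
  fix i assume i: "1 \<le> i" "i \<le> CARD('n)"
  show "phi_inv (frac_lin (A_phi c) x) $ c i = x $ c i"
  proof (cases "i = n")
    case True
    thus ?thesis
      using pos unfolding True phi_inv_last last frac_lin_A_phi_last by simp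
  next
    case False
    hence i': "1 \<le> i" "i < n" using i by (auto simp: n_def)
    have 1: "(if i = n - 1 then 1 else frac_lin (A_phi c) x $ c (n - 1 - i)) =
        partial_sum c x i / partial_sum c x (n - 1)"
      using i' pos by (auto simp: frac_lin_A_phi_less)
    have 2: "frac_lin (A_phi c) x $ c (n - i) = partial_sum c x (i - 1) / partial_sum c x (n - 1)"
      using i' by (simp add: frac_lin_A_phi_less)
    show ?thesis
      unfolding phi_inv_less[OF i'] 1 2 last
      using pos partial_sum_diff[OF i'(1), of c x] by (simp add: diff_divide_distrib[symmetric])
  qed
qed

text \<open>The numerators of the coordinates of \<open>phi_inv y\<close> telescope, starting from
  \<open>S\<^sub>0 = y\<^sub>n\<^sub>-\<^sub>1 / y\<^sub>n\<^sub>-\<^sub>1\<close>.\<close>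

lemma partial_sum_phi_inv:
  assumes "y \<in> halfspace c" "m < n"
  shows "partial_sum c (phi_inv y) m = (if m = n - 1 then 1 else y $ c (n - 1 - m)) / y $ c (n - 1)"
  using assms(2)
proof (induction m)
  case 0
  thus ?case using assms(1) card2 by (auto simp: halfspace_def n_def)
next
  case (Suc m)
  thus ?case
    using phi_inv_less[of "Suc m" y]
    by (auto simp: partial_sum_Suc add_divide_distrib[symmetric])
qed

lemma phi_inv_mem:
  assumes "y \<in> halfspace c"
  shows "phi_inv y \<in> dual_halfspace c"
  using assms partial_sum_phi_inv[OF assms, of "n - 1"] card2
  by (simp add: halfspace_def dual_halfspace_def n_def)

lemma frac_lin_A_phi_phi_inv:
  assumes "y \<in> halfspace c"
  shows "frac_lin (A_phi c) (phi_inv y) = y"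
proof (rule vec_eq_numbering[OF num])
  have pos: "y $ c (n - 1) > 0"
    using assms by (simp add: halfspace_def n_def)
  fix i assume i: "1 \<le> i" "i \<le> CARD('n)"
  show "frac_lin (A_phi c) (phi_inv y) $ c i = y $ c i"
  proof (cases "i = n")
    case True
    have "partial_sum c (phi_inv y) (n - 1) = 1 / y $ c (n - 1)"
      using partial_sum_phi_inv[OF assms, of "n - 1"] card2 by (simp add: n_def)
    thus ?thesis
      using pos unfolding True frac_lin_A_phi_last phi_inv_last by simp
  next
    case False
    thus ?thesis using pos i card2
      by (auto simp: frac_lin_A_phi_less partial_sum_phi_inv[OF assms] n_def)
  qed
qed

lemma bij_betw_frac_lin_A_phi:
  "bij_betw (frac_lin (A_phi c)) (dual_halfspace c) (halfspace c)"
  by (rule bij_betw_byWitness[where f' = phi_inv])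
    (auto simp: phi_inv_frac_lin_A_phi frac_lin_A_phi_phi_inv phi_inv_mem frac_lin_A_phi_mem)

section \<open>Differentiability and continuity\<close>

lemma frac_lin_A_phi_differentiable:
  assumes "x \<in> dual_halfspace c"
  shows "frac_lin (A_phi c) differentiable (at x)"
proof -
  let ?den = "\<lambda>x. A_phi c $ None $ None + (\<Sum>m\<in>UNIV. A_phi c $ None $ Some m * x $ m)"
  have nth: "(\<lambda>x::real^'n. x $ m) differentiable (at x)" for m
    by (simp add: bounded_linear_imp_differentiable bounded_linear_vec_nth)
  have "?den x \<noteq> 0"
    using assms unfolding frac_lin_A_phi_denominator by (simp add: dual_halfspace_def n_def)
  hence comp: "(\<lambda>x. (A_phi c $ Some l $ None + (\<Sum>m\<in>UNIV. A_phi c $ Some l $ Some m * x $ m)) / ?den x)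
      differentiable (at x)" for l
    by (intro differentiable_divide differentiable_add differentiable_const differentiable_sum
        differentiable_mult nth finite_UNIV ballI) auto
  show ?thesis
    unfolding frac_lin_def using comp
    by (subst differentiable_componentwise_within) (auto simp: Basis_vec_def inner_axis)
qed

lemma continuous_on_frac_lin_A_phi: "continuous_on (dual_halfspace c) (frac_lin (A_phi c))"
  by (intro differentiable_imp_continuous_on)
    (auto simp: differentiable_on_def intro!: differentiable_at_withinI frac_lin_A_phi_differentiable)

section \<open>Domains and pieces under \<phi>\<close>

lemma one_minus_frac_lin_A_phi_first:
  assumes "x \<in> dual_halfspace c"
  shows "1 - frac_lin (A_phi c) x $ c 1 = x $ c (n - 1) / partial_sum c x (n - 1)"
proof -
  have pos: "partial_sum c x (n - 1) > 0"
    using assms by (simp add: dual_halfspace_def n_def)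
  have "frac_lin (A_phi c) x $ c 1 = partial_sum c x (n - 1 - 1) / partial_sum c x (n - 1)"
    using frac_lin_A_phi_less[of 1] card2 by (simp add: n_def)
  moreover have "partial_sum c x (n - 1) - partial_sum c x (n - 1 - 1) = x $ c (n - 1)"
    using partial_sum_diff[of "n - 1" c x] card2 by (simp add: n_def)
  ultimately show ?thesis
    using pos by (simp add: field_simps)
qed

lemma dual_domain_upper_subset: "GS_dual_domain_upper c \<subseteq> dual_halfspace c"
  using partial_sum_ge_1[of "CARD('n) - 1" _ c]
  by (fastforce simp: GS_dual_domain_upper_def dual_halfspace_def)

lemma dual_domain_subset: "GS_dual_domain c \<subseteq> dual_halfspace c"
  using partial_sum_ge_1[of "CARD('n) - 1" _ c]
  by (fastforce simp: GS_dual_domain_def dual_halfspace_def)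

lemma GS_domain_subset: "GS_domain c \<subseteq> halfspace c"
proof
  fix y assume y: "y \<in> GS_domain c"
  have "n - 1 \<in> {1..<CARD('n)}" using card2 by (auto simp: n_def)
  hence "y $ c (n - 1 + 1) \<le> y $ c (n - 1)" using y unfolding GS_domain_def by blast
  thus "y \<in> halfspace c" using y card2 by (auto simp: GS_domain_def halfspace_def n_def)
qed

text \<open>Multiplying by the positive denominator turns the inequalities into each other one by
  one: \<open>y\<^sub>1 \<le> 1\<close> into \<open>x\<^sub>n\<^sub>-\<^sub>1 \<ge> 0\<close>, each
  later link of the chain into the sign of one earlier coordinate, the link between
  \<open>y\<^sub>n\<close> and \<open>y\<^sub>n\<^sub>-\<^sub>1\<close> into
  \<open>x\<^sub>n \<le> 1\<close>, and \<open>y\<^sub>n > 0\<close> into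
  \<open>x\<^sub>n > 0\<close>.\<close>

lemma frac_lin_A_phi_mem_GS_domain_iff:
  assumes "x \<in> dual_halfspace c"
  shows "frac_lin (A_phi c) x \<in> GS_domain c \<longleftrightarrow> x \<in> GS_dual_domain_upper c"
proof -
  let ?y = "frac_lin (A_phi c) x"
  have pos: "partial_sum c x (n - 1) > 0"
    using assms by (simp add: dual_halfspace_def n_def)
  have first: "?y $ c 1 \<le> 1 \<longleftrightarrow> 0 \<le> x $ c (n - 1)"
    using one_minus_frac_lin_A_phi_first[OF assms] pos
    by (metis diff_ge_0_iff_ge zero_le_divide_iff less_imp_le not_less)
  have last: "0 < ?y $ c n \<longleftrightarrow> 0 < x $ c n"
    using pos by (auto simp: frac_lin_A_phi_last zero_less_divide_iff)
  have step: "?y $ c (i + 1) \<le> ?y $ c i \<longleftrightarrow> 0 \<le> x $ c (n - 1 - i)" if "i \<in> {1..<n - 1}" for i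
  proof -
    have "?y $ c i = partial_sum c x (n - 1 - i) / partial_sum c x (n - 1)"
      "?y $ c (i + 1) = partial_sum c x (n - 1 - i - 1) / partial_sum c x (n - 1)"
      using frac_lin_A_phi_less[of i x] frac_lin_A_phi_less[of "i + 1" x] that by auto
    moreover have "partial_sum c x (n - 1 - i) - partial_sum c x (n - 1 - i - 1) = x $ c (n - 1 - i)"
      using that by (intro partial_sum_diff) auto
    ultimately show ?thesis
      using pos by (auto simp: divide_le_cancel)
  qed
  have top: "?y $ c (n - 1 + 1) \<le> ?y $ c (n - 1) \<longleftrightarrow> x $ c n \<le> 1"
    using frac_lin_A_phi_less[of "n - 1" x] frac_lin_A_phi_last[of x] card2 pos
    by (auto simp: n_def divide_le_cancel)
  \<comment> \<open>The last link is split off because the numerator of \<open>y\<^sub>n\<close> is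
    \<open>x\<^sub>n\<close> and not a partial sum.\<close>
  have range: "{1..<n} = insert (n - 1) {1..<n - 1}" using card2 by (auto simp: n_def)
  have steps: "(\<forall>i\<in>{1..<n}. ?y $ c (i + 1) \<le> ?y $ c i) \<longleftrightarrow>
      x $ c n \<le> 1 \<and> (\<forall>i\<in>{1..<n - 1}. 0 \<le> x $ c (n - 1 - i))"
    unfolding range ball_insert top using step by blast
  \<comment> \<open>The reflection in the chain reaches only the indices 1 to \<open>n - 2\<close>;
    the sign of \<open>x\<^sub>n\<^sub>-\<^sub>1\<close> comes from \<open>first\<close>.\<close>
  have "{1..n - 1} = insert (n - 1) ((\<lambda>i. n - 1 - i) ` {1..<n - 1})"
  proof (intro equalityI subsetI)
    fix j assume j: "j \<in> {1..n - 1}"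
    show "j \<in> insert (n - 1) ((\<lambda>i. n - 1 - i) ` {1..<n - 1})"
    proof (cases "j = n - 1")
      case False
      hence "j = n - 1 - (n - 1 - j)" "n - 1 - j \<in> {1..<n - 1}" using j by auto
      thus ?thesis by blast
    qed simp
  qed (use card2 in \<open>auto simp: n_def\<close>)
  hence "(\<forall>j\<in>{1..n - 1}. 0 \<le> x $ c j) \<longleftrightarrow>
      0 \<le> x $ c (n - 1) \<and> (\<forall>i\<in>{1..<n - 1}. 0 \<le> x $ c (n - 1 - i))"
    by auto
  thus ?thesis
    using first last steps unfolding GS_domain_def GS_dual_domain_upper_def n_def[symmetric]
    by auto
qed

lemma frac_lin_A_phi_mem_GS_null_face_iff:
  assumes "x \<in> dual_halfspace c"
  shows "frac_lin (A_phi c) x \<in> GS_null_face c \<longleftrightarrow> x \<in> GS_dual_domain_upper c \<and> x $ c n = 1"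
proof -
  have "partial_sum c x (n - 1) > 0"
    using assms by (simp add: dual_halfspace_def n_def)
  hence "frac_lin (A_phi c) x $ c n = frac_lin (A_phi c) x $ c (n - 1) \<longleftrightarrow> x $ c n = 1"
    using frac_lin_A_phi_less[of "n - 1" x] frac_lin_A_phi_last[of x] card2
    by (auto simp: n_def)
  thus ?thesis
    using frac_lin_A_phi_mem_GS_domain_iff[OF assms] by (simp add: GS_null_face_def n_def)
qed

text \<open>Both sides require \<open>0 < x\<^sub>n < 1\<close>. Hence the version with deleted
  faces is a restriction of the version with the upper face.\<close>

lemma dual_domain_diff_null_face:
  "GS_dual_domain c - GS_dual_null_face c = {x \<in> GS_dual_domain_upper c. x $ c n \<noteq> 1}"
  by (auto simp: GS_dual_domain_def GS_dual_null_face_def GS_dual_domain_upper_def n_def)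

text \<open>The two digit inequalities on the side of \<phi>(x) are those for \<open>x\<close>
  divided by the positive denominator. The null face must be removed because it corresponds to
  \<open>x\<^sub>n = 1\<close>, which the dual pieces exclude.\<close>

lemma frac_lin_A_phi_mem_GS_piece_iff:
  assumes "x \<in> dual_halfspace c"
  shows "frac_lin (A_phi c) x \<in> GS_piece c k - GS_null_face c \<longleftrightarrow> x \<in> GS_dual_piece c k"
proof -
  let ?y = "frac_lin (A_phi c) x"
  have pos: "partial_sum c x (n - 1) > 0"
    using assms by (simp add: dual_halfspace_def n_def)
  have eq: "1 - ?y $ c 1 - a * ?y $ c n = (x $ c (n - 1) - a * x $ c n) / partial_sum c x (n - 1)" for a
    using one_minus_frac_lin_A_phi_first[OF assms] pos
    by (simp add: frac_lin_A_phi_last diff_divide_distrib)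
  \<comment> \<open>The two digit inequalities together force \<open>x\<^sub>n > 0\<close>, so a
    dual piece never meets the face \<open>x\<^sub>n = 0\<close>.\<close>
  have "x \<in> GS_dual_piece c k \<longleftrightarrow> x \<in> GS_dual_domain_upper c \<and> x $ c n \<noteq> 1 \<and>
      x $ c (n - 1) - real k * x $ c n \<ge> 0 \<and> 0 > x $ c (n - 1) - (real k + 1) * x $ c n"
    by (auto simp: GS_dual_piece_def GS_dual_domain_def GS_dual_domain_upper_def n_def Let_def
        algebra_simps less_le)
  moreover have "?y \<in> GS_piece c k - GS_null_face c \<longleftrightarrow> x \<in> GS_dual_domain_upper c \<and> x $ c n \<noteq> 1 \<and>
      1 - ?y $ c 1 - real k * ?y $ c n \<ge> 0 \<and> 0 > 1 - ?y $ c 1 - (real k + 1) * ?y $ c n"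
    using frac_lin_A_phi_mem_GS_domain_iff[OF assms] frac_lin_A_phi_mem_GS_null_face_iff[OF assms]
    by (auto simp: GS_piece_def Let_def n_def)
  ultimately show ?thesis
    using pos unfolding eq by (auto simp: zero_le_divide_iff divide_less_0_iff)
qed

section \<open>The intertwining relation\<close>

lemma frac_lin_A_phi_dual_map:
  assumes x: "x \<in> GS_dual_domain_upper c"
  shows "frac_lin (A_phi c) (GS_dual_map c x) = GS_map c (frac_lin (A_phi c) x)"
proof (rule vec_eq_numbering[OF num])
  let ?y = "frac_lin (A_phi c) x" and ?z = "GS_dual_map c x"
  let ?S = "partial_sum c x"
  define k where "k = \<lfloor>x $ c (n - 1) / x $ c n\<rfloor>"
  have U: "x \<in> dual_halfspace c" using x dual_domain_upper_subset by blast
  have xn: "x $ c n > 0" using x by (simp add: GS_dual_domain_upper_def n_def)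
  have pos: "?S m > 0" if "m < n" for m
  proof -
    have "?S m \<ge> 1"
      using x that by (intro partial_sum_ge_1) (auto simp: GS_dual_domain_upper_def n_def)
    thus ?thesis by simp
  qed
  have n2: "n \<ge> 2" using card2 by (simp add: n_def)
  have z1: "?z $ c 1 = (1 - x $ c n) / x $ c n"
    using position_numbering[OF num, of 1] card2 by (simp add: GS_dual_map_def Let_def n_def)
  have zi: "?z $ c i = x $ c (i - 1) / x $ c n" if "2 \<le> i" "i < n" for i
    using position_numbering[OF num, of i] that by (simp add: GS_dual_map_def Let_def n_def)
  have zn: "?z $ c n = (x $ c (n - 1) - of_int k * x $ c n) / x $ c n"
    using position_numbering[OF num, of n] card2 by (simp add: GS_dual_map_def Let_def n_def k_def)
  \<comment> \<open>The first coordinate of \<open>?z\<close> completes the leading 1 to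
    \<open>1 / x\<^sub>n\<close>, and each further one adds the next term of the old sum over
    \<open>x\<^sub>n\<close>. Coordinate \<open>n\<close> carries the digit and stays outside the
    range.\<close>
  have Sz: "partial_sum c ?z (Suc m) = ?S m / x $ c n" if "Suc m < n" for m
    using that
  proof (induction m)
    case 0
    show ?case using z1 xn by (simp add: partial_sum_Suc field_simps)
  next
    case (Suc m)
    thus ?case using zi[of "Suc (Suc m)"]
      by (simp add: partial_sum_Suc[of c _ "Suc m"] partial_sum_Suc[of c x] add_divide_distrib)
  qed
  have Sz_top: "partial_sum c ?z (n - 1) = ?S (n - 2) / x $ c n"
    using Sz[of "n - 2"] n2 by (simp add: Suc_diff_Suc numeral_2_eq_2)
  have y1: "?y $ c 1 = ?S (n - 2) / ?S (n - 1)"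
    using frac_lin_A_phi_less[of 1 x] n2 by (simp add: numeral_2_eq_2)
  \<comment> \<open>The denominator of \<phi> cancels, so both maps take the floor of the same
    number and use the same digit \<open>k\<close>.\<close>
  have digit: "(1 - ?y $ c 1) / ?y $ c n = x $ c (n - 1) / x $ c n"
    using pos[of "n - 1"] n2
    unfolding one_minus_frac_lin_A_phi_first[OF U] frac_lin_A_phi_last by simp
  have p1: "?S (n - 1) > 0" and p2: "?S (n - 2) > 0"
    using pos[of "n - 1"] pos[of "n - 2"] n2 by auto
  fix i assume "1 \<le> i" "i \<le> CARD('n)"
  hence i: "1 \<le> i" "i \<le> n" by (auto simp: n_def)
  \<comment> \<open>Coordinate \<open>n\<close> involves the digit; at \<open>n - 1\<close> the map
    \<open>GS_map\<close> shifts in \<open>y\<^sub>n\<close>, which is not a quotient of partial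
    sums; below that only partial sums are compared.\<close>
  consider "i = n" | "i = n - 1" "i < n" | "i < n - 1" using i by linarith
  thus "frac_lin (A_phi c) ?z $ c i = GS_map c ?y $ c i"
  proof cases
    case 1
    have "GS_map c ?y $ c n = (1 - ?y $ c 1 - of_int k * ?y $ c n) / ?y $ c 1"
      using position_numbering[OF num, of n] card2 digit
      by (simp add: GS_map_def Let_def n_def k_def)
    also have "\<dots> = (x $ c (n - 1) - of_int k * x $ c n) / ?S (n - 2)"
      unfolding one_minus_frac_lin_A_phi_first[OF U] frac_lin_A_phi_last
      unfolding y1 using p1 p2 by (simp add: field_simps)
    also have "\<dots> = frac_lin (A_phi c) ?z $ c n"
      using xn p2 unfolding frac_lin_A_phi_last Sz_top zn by simp
    finally show ?thesis using 1 by simp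
  next
    case 2
    have "GS_map c ?y $ c i = ?y $ c n / ?y $ c 1"
      using position_numbering[OF num, of i] 2 i by (simp add: GS_map_def Let_def n_def)
    also have "\<dots> = x $ c n / ?S (n - 2)"
      using p1 p2 unfolding y1 frac_lin_A_phi_last by simp
    also have "\<dots> = frac_lin (A_phi c) ?z $ c i"
      unfolding frac_lin_A_phi_less[OF i(1) 2(2)] Sz_top using xn p2 2 by simp
    finally show ?thesis by simp
  next
    case 3
    have "position c (c i) = i" "i < CARD('n)"
      using position_numbering[OF num, of i] 3 i by (auto simp: n_def)
    hence "GS_map c ?y $ c i = ?y $ c (i + 1) / ?y $ c 1"
      unfolding GS_map_def Let_def by simp
    also have "?y $ c (i + 1) = ?S (n - 2 - i) / ?S (n - 1)"
    proof -
      have "n - 1 - (i + 1) = n - 2 - i" "i + 1 < n" using 3 by auto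
      thus ?thesis using frac_lin_A_phi_less[of "i + 1" x] by simp
    qed
    also have "?S (n - 2 - i) / ?S (n - 1) / ?y $ c 1 = ?S (n - 2 - i) / ?S (n - 2)"
      unfolding y1 using p1 p2 by simp
    also have "\<dots> = frac_lin (A_phi c) ?z $ c i"
    proof -
      have m: "n - 1 - i = Suc (n - 2 - i)" "Suc (n - 2 - i) < n" "i < n" using 3 i by auto
      show ?thesis
        unfolding frac_lin_A_phi_less[OF i(1) m(3)] Sz_top m(1) Sz[OF m(2)]
        using xn p2 by simp
    qed
    finally show ?thesis by simp
  qed
qed

section \<open>Interiors of the pieces\<close>

lemma null_face_hyperplane:
  fixes y :: "real ^ 'n"
  shows "y $ c (n - 1) = y $ c n \<longleftrightarrow> (axis (c n) 1 - axis (c (n - 1)) 1) \<bullet> y = 0"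
proof -
  have "(axis (c n) 1 - axis (c (n - 1)) 1) \<bullet> y = y $ c n - y $ c (n - 1)"
    by (simp add: inner_diff_left inner_axis')
  thus ?thesis by linarith
qed

lemma null_face_normal_nonzero: "axis (c n) (1::real) - axis (c (n - 1)) 1 \<noteq> 0"
proof -
  have "n \<noteq> n - 1" "n \<in> {1..CARD('n)}" "n - 1 \<in> {1..CARD('n)}"
    using card2 by (auto simp: n_def)
  hence "c n \<noteq> c (n - 1)" using numbering_inj[OF num] by blast
  thus ?thesis by (simp add: axis_eq_axis)
qed

text \<open>The piece lies on one side of the hyperplane that contains the null face. Passing to
  interiors therefore absorbs the exception in
  \<open>frac_lin_A_phi_mem_GS_piece_iff\<close>.\<close>

lemma interior_GS_piece_disjoint_null_face: "interior (GS_piece c k) \<inter> GS_null_face c = {}"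
proof -
  let ?a = "axis (c n) (1::real) - axis (c (n - 1)) 1"
  have "GS_piece c k \<subseteq> {y. ?a \<bullet> y \<le> 0}"
  proof
    fix y assume "y \<in> GS_piece c k"
    hence "\<forall>i\<in>{1..<CARD('n)}. y $ c (i + 1) \<le> y $ c i" by (simp add: GS_piece_def GS_domain_def)
    moreover have "n - 1 \<in> {1..<CARD('n)}" using card2 by (auto simp: n_def)
    ultimately have "y $ c (n - 1 + 1) \<le> y $ c (n - 1)" by blast
    thus "y \<in> {y. ?a \<bullet> y \<le> 0}" using card2 by (simp add: inner_diff_left inner_axis' n_def)
  qed
  hence "interior (GS_piece c k) \<subseteq> {y. ?a \<bullet> y < 0}"
    unfolding interior_halfspace_le[OF null_face_normal_nonzero, symmetric] by (rule interior_mono)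
  moreover have "?a \<bullet> y = 0" if "y \<in> GS_null_face c" for y
    unfolding null_face_hyperplane[symmetric] using that by (simp add: GS_null_face_def n_def)
  ultimately show ?thesis by fastforce
qed

lemma image_interior_GS_dual_piece:
  "frac_lin (A_phi c) ` interior (GS_dual_piece c k) = interior (GS_piece c k)" (is "?f ` _ = _")
proof
  have sub: "GS_dual_piece c k \<subseteq> dual_halfspace c"
    using dual_domain_subset by (auto simp: GS_dual_piece_def)
  \<comment> \<open>An open subset of the piece lies in its interior, so openness of the image gives
    the first inclusion.\<close>
  have "open (?f ` interior (GS_dual_piece c k))"
  proof (rule invariance_of_domain)
    have "interior (GS_dual_piece c k) \<subseteq> dual_halfspace c"
      using sub interior_subset by blast
    thus "continuous_on (interior (GS_dual_piece c k)) ?f" "inj_on ?f (interior (GS_dual_piece c k))"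
      using continuous_on_subset[OF continuous_on_frac_lin_A_phi]
        inj_on_subset[OF bij_betw_imp_inj_on[OF bij_betw_frac_lin_A_phi]] by blast+
  qed simp
  moreover have "?f ` interior (GS_dual_piece c k) \<subseteq> GS_piece c k"
    using sub frac_lin_A_phi_mem_GS_piece_iff interior_subset by fastforce
  ultimately show "?f ` interior (GS_dual_piece c k) \<subseteq> interior (GS_piece c k)"
    by (rule interior_maximal[rotated])
next
  \<comment> \<open>For the converse the preimage is taken within the open half-space, where
    continuity makes it open; its image avoids the null face, so it lies in the dual piece.\<close>
  let ?W = "dual_halfspace c \<inter> ?f -` interior (GS_piece c k)"
  have "open ?W"
    using continuous_on_open_vimage[OF open_dual_halfspace[of c]] continuous_on_frac_lin_A_phi
    by (metis Int_commute open_interior)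
  moreover have "?W \<subseteq> GS_dual_piece c k"
    using frac_lin_A_phi_mem_GS_piece_iff interior_GS_piece_disjoint_null_face interior_subset
    by fastforce
  ultimately have W: "?W \<subseteq> interior (GS_dual_piece c k)"
    by (rule interior_maximal[rotated])
  show "interior (GS_piece c k) \<subseteq> ?f ` interior (GS_dual_piece c k)"
  proof
    fix y assume y: "y \<in> interior (GS_piece c k)"
    hence "y \<in> halfspace c"
      using interior_subset GS_domain_subset by (fastforce simp: GS_piece_def)
    then obtain x where "x \<in> dual_halfspace c" "y = ?f x"
      using bij_betw_frac_lin_A_phi unfolding bij_betw_def by blast
    thus "y \<in> ?f ` interior (GS_dual_piece c k)" using y W by blast
  qed
qed

section \<open>Self-duality for both adjustments of the boundary faces\<close>

lemma self_dual_via_frac_lin_A_phi: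
  assumes X': "X' \<subseteq> GS_dual_domain_upper c" and X: "X \<subseteq> GS_domain c"
    and iff: "\<And>x. x \<in> dual_halfspace c \<Longrightarrow> frac_lin (A_phi c) x \<in> X \<longleftrightarrow> x \<in> X'"
  shows "self_dual_via (frac_lin (A_phi c)) X' (GS_dual_map c) (GS_dual_piece c)
    X (GS_map c) (GS_piece c)"
proof -
  let ?f = "frac_lin (A_phi c)"
  have sub: "X' \<subseteq> dual_halfspace c" "X \<subseteq> halfspace c"
    using X' X dual_domain_upper_subset GS_domain_subset by auto
  \<comment> \<open>By \<open>iff\<close>, \<open>X'\<close> is the full preimage of
    \<open>X\<close> in the half-space, so the bijection of half-spaces restricts to one from
    \<open>X'\<close> onto \<open>X\<close>.\<close>
  have "?f ` X' = X"
  proof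
    show "X \<subseteq> ?f ` X'"
      using sub iff bij_betw_imp_surj_on[OF bij_betw_frac_lin_A_phi] by (fastforce simp: image_iff)
  qed (use sub iff in auto)
  hence "bij_betw ?f X' X"
    using bij_betw_subset[OF bij_betw_frac_lin_A_phi sub(1)] by simp
  moreover have "?f differentiable_on X'"
    using sub by (auto simp: differentiable_on_def
        intro!: differentiable_at_withinI frac_lin_A_phi_differentiable)
  moreover have "?f \<in> restrict_space borel X' \<rightarrow>\<^sub>M restrict_space borel X"
    using sub iff borel_measurable_continuous_on_restrict[OF
        continuous_on_subset[OF continuous_on_frac_lin_A_phi sub(1)]]
    by (intro measurable_restrict_space2) (auto simp: space_restrict_space)
  moreover have "\<forall>x\<in>X'. ?f (GS_dual_map c x) = GS_map c (?f x)"
    using X' frac_lin_A_phi_dual_map by blast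
  \<comment> \<open>The condition on interiors mentions only the pieces and is the same for every
    choice of \<open>X'\<close> and \<open>X\<close>.\<close>
  ultimately show ?thesis
    using image_interior_GS_dual_piece by (simp add: self_dual_via_def)
qed

text \<open>Together with its dual counterpart this shows that deleting the two faces changes the
  domains only by null sets.\<close>

lemma negligible_GS_null_face: "negligible (GS_null_face c)"
proof (rule negligible_subset)
  show "negligible {y. (axis (c n) (1::real) - axis (c (n - 1)) 1) \<bullet> y = 0}"
    using null_face_normal_nonzero by (intro negligible_hyperplane) auto
  show "GS_null_face c \<subseteq> {y. (axis (c n) (1::real) - axis (c (n - 1)) 1) \<bullet> y = 0}"
    unfolding null_face_hyperplane[symmetric] by (auto simp: GS_null_face_def n_def)
qed

end

lemma negligible_GS_dual_null_face: "negligible (GS_dual_null_face c)"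
  for c :: "nat \<Rightarrow> 'n::finite"
proof (rule negligible_subset)
  show "negligible {x::real^'n. axis (c CARD('n)) (1::real) \<bullet> x = 0}"
    by (intro negligible_hyperplane) (auto simp: axis_eq_0_iff)
  show "GS_dual_null_face c \<subseteq> {x. axis (c CARD('n)) (1::real) \<bullet> x = 0}"
    by (auto simp: GS_dual_null_face_def inner_axis')
qed

text \<open>The last three conjuncts record what holds on the half-open dual domain itself, whose
  image under \<phi> is not \<open>GS_domain\<close>.\<close>

theorem proposition2:
  fixes c :: "nat \<Rightarrow> 'n::finite"
  assumes "CARD('n) \<ge> 2" and "numbering c"
  defines "\<phi> \<equiv> frac_lin (A_phi c)"
  shows "invertible (A_phi c) \<and>
    self_dual_via \<phi>
      (GS_dual_domain c - GS_dual_null_face c) (GS_dual_map c) (GS_dual_piece c)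
      (GS_domain c - GS_null_face c) (GS_map c) (GS_piece c) \<and>
    negligible (GS_dual_null_face c) \<and> negligible (GS_null_face c) \<and>
    self_dual_via \<phi>
      (GS_dual_domain_upper c) (GS_dual_map c) (GS_dual_piece c)
      (GS_domain c) (GS_map c) (GS_piece c) \<and>
    inj_on \<phi> (GS_dual_domain c) \<and>
    (\<forall>x\<in>GS_dual_domain c. \<phi> differentiable (at x)) \<and>
    \<phi> \<in> borel_measurable (restrict_space borel (GS_dual_domain c))"
proof -
  note ctx = assms(2,1)
  note sub = dual_domain_subset[OF ctx]
  have "self_dual_via \<phi>
      (GS_dual_domain c - GS_dual_null_face c) (GS_dual_map c) (GS_dual_piece c)
      (GS_domain c - GS_null_face c) (GS_map c) (GS_piece c)"
    unfolding \<phi>_def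
    using dual_domain_diff_null_face[OF ctx] frac_lin_A_phi_mem_GS_domain_iff[OF ctx]
      frac_lin_A_phi_mem_GS_null_face_iff[OF ctx]
    by (intro self_dual_via_frac_lin_A_phi[OF ctx]) auto
  moreover have "self_dual_via \<phi>
      (GS_dual_domain_upper c) (GS_dual_map c) (GS_dual_piece c)
      (GS_domain c) (GS_map c) (GS_piece c)"
    unfolding \<phi>_def
    by (intro self_dual_via_frac_lin_A_phi[OF ctx] frac_lin_A_phi_mem_GS_domain_iff[OF ctx]) auto
  moreover have "inj_on \<phi> (GS_dual_domain c)"
    unfolding \<phi>_def using inj_on_subset[OF bij_betw_imp_inj_on[OF bij_betw_frac_lin_A_phi[OF ctx]] sub] .
  moreover have "\<forall>x\<in>GS_dual_domain c. \<phi> differentiable (at x)"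
    unfolding \<phi>_def using frac_lin_A_phi_differentiable[OF ctx] sub by blast
  moreover have "\<phi> \<in> borel_measurable (restrict_space borel (GS_dual_domain c))"
    unfolding \<phi>_def
    by (intro borel_measurable_continuous_on_restrict
        continuous_on_subset[OF continuous_on_frac_lin_A_phi[OF ctx] sub])
  ultimately show ?thesis
    using invertible_A_phi[OF ctx] negligible_GS_dual_null_face negligible_GS_null_face[OF ctx]
    by blast
qed

end
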